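(* Let $P=[p_{ij}]$ be the $m\times m$ transition matrix ($m\ge 2$) of an irreducible, aperiodic Markov chain with finite state space, and let $\boldsymbol{\pi}=[\pi_1,\ldots,\pi_m]$ be its unique stationary distribution. Suppose that the eigenvalues $\lambda_1,\ldots,\lambda_m\in\mathbb{C}$ of $P$ are all non-zero and simple, labelled so that $\lambda_1=1$ is the dominant eigenvalue, and let $\rho=\max_{|\lambda_k|\neq \lambda_1}|\lambda_k|$. Then for all $i,j\in\{1,\ldots,m\}$ and all integers $n\ge 1$, $$\left|p_{ij}^{(n)}-\pi_j\right|\le \Phi\,\rho^n,$$ where $$\Phi=\Phi_{ij}=\sum_{k=2}^m \frac{\left|\sum_{l=1}^m(-1)^{m-l}e_{m-l}(\lambda_1,\ldots,\widehat{\lambda_k},\ldots,\lambda_m)\,p_{ij}^{(l)}\right|}{|\lambda_k|\prod_{1\le t\le m,\ t\ne k}|\lambda_k-\lambda_t|}.$$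
   Context: A transition matrix is a matrix $P=[p_{ij}]$ with non-negative real entries whose rows each sum to $1$. Write $P^n=[p_{ij}^{(n)}]$ for its powers; $p_{ij}^{(n)}$ is the $n$-step transition probability. The chain is irreducible if for all $i,j$ there is $n\ge 1$ with $p_{ij}^{(n)}>0$. The period of state $i$ is $\gcd\{n\ge 1: p_{ii}^{(n)}>0\}$; for an irreducible chain all states have the same period, and the chain is aperiodic if this period is $1$. A stationary distribution is a row vector $\boldsymbol{\pi}$ with non-negative entries summing to $1$ and $\boldsymbol{\pi}P=\boldsymbol{\pi}$; for an irreducible aperiodic chain it exists and is unique. The dominant eigenvalue of an irreducible non-negative matrix is its Perron–Frobenius eigenvalue (real, positive, and of maximal modulus); for a transition matrix it equals $1$, and in the irreducible aperiodic case all other eigenvalues have modulus strictly less than $1$. Here $e_j$ is the $j$-th elementary symmetric polynomial ($e_0=1$), and $e_j(\lambda_1,\ldots,\widehat{\lambda_k},\ldots,\lambda_m)$ denotes $e_j$ evaluated at the $m-1$ numbers obtained by omitting $\lambda_k$. *)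

theory Defs
  imports Complex_Main "Jordan_Normal_Form.Char_Poly"
begin

text \<open>
  States are numbered from 0 to \<open>m - 1\<close>, following the indexing of matrices and vectors.
  Eigenvalues are numbered from 1 to \<open>m\<close>.
\<close>

definition transition_matrix :: "nat \<Rightarrow> real mat \<Rightarrow> bool" where
  "transition_matrix m P \<longleftrightarrow>
     P \<in> carrier_mat m m \<and>
     (\<forall>i<m. \<forall>j<m. P $$ (i, j) \<ge> 0) \<and>
     (\<forall>i<m. (\<Sum>j<m. P $$ (i, j)) = 1)"

definition transition_prob :: "real mat \<Rightarrow> nat \<Rightarrow> nat \<Rightarrow> nat \<Rightarrow> real" where
  "transition_prob P n i j = (P ^\<^sub>m n) $$ (i, j)"

definition irreducible_chain :: "nat \<Rightarrow> real mat \<Rightarrow> bool" where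
  "irreducible_chain m P \<longleftrightarrow> (\<forall>i<m. \<forall>j<m. \<exists>n\<ge>1. transition_prob P n i j > 0)"

definition period :: "real mat \<Rightarrow> nat \<Rightarrow> nat" where
  "period P i = Gcd {n. n \<ge> 1 \<and> transition_prob P n i i > 0}"

definition aperiodic_chain :: "nat \<Rightarrow> real mat \<Rightarrow> bool" where
  "aperiodic_chain m P \<longleftrightarrow> (\<forall>i<m. period P i = 1)"

text \<open>The last conjunct is the row-vector equation \<open>\<pi> P = \<pi>\<close>.\<close>

definition stationary_distribution :: "nat \<Rightarrow> real mat \<Rightarrow> real vec \<Rightarrow> bool" where
  "stationary_distribution m P \<pi> \<longleftrightarrow>
     \<pi> \<in> carrier_vec m \<and>
     (\<forall>j<m. \<pi> $ j \<ge> 0) \<and>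
     (\<Sum>j<m. \<pi> $ j) = 1 \<and>
     (\<forall>j<m. (\<Sum>i<m. \<pi> $ i * P $$ (i, j)) = \<pi> $ j)"

text \<open>Simplicity is algebraic: the eigenvalue is a simple root of the characteristic polynomial.\<close>

definition simple_eigenvalue :: "'a::field mat \<Rightarrow> 'a \<Rightarrow> bool" where
  "simple_eigenvalue A x \<longleftrightarrow> eigenvalue A x \<and> order x (char_poly A) = 1"

text \<open>
  The elementary symmetric polynomial \<open>e\<^sub>j\<close>, evaluated at the finite family
  \<open>(x\<^sub>t)\<close> with \<open>t\<close> ranging over the index set \<open>T\<close>.
\<close>

definition elem_sym :: "nat \<Rightarrow> 'i set \<Rightarrow> ('i \<Rightarrow> 'a::comm_semiring_1) \<Rightarrow> 'a" where
  "elem_sym j T x = (\<Sum>S | S \<subseteq> T \<and> card S = j. \<Prod>t\<in>S. x t)"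

definition rho :: "nat \<Rightarrow> (nat \<Rightarrow> complex) \<Rightarrow> real" where
  "rho m lam = Max {cmod (lam k) |k. k \<in> {1..m} \<and> complex_of_real (cmod (lam k)) \<noteq> lam 1}"

definition Phi :: "nat \<Rightarrow> real mat \<Rightarrow> (nat \<Rightarrow> complex) \<Rightarrow> nat \<Rightarrow> nat \<Rightarrow> real" where
  "Phi m P lam i j =
     (\<Sum>k=2..m.
        cmod (\<Sum>l=1..m. (-1) ^ (m - l) * elem_sym (m - l) ({1..m} - {k}) lam
                          * complex_of_real (transition_prob P l i j))
        / (cmod (lam k) * (\<Prod>t\<in>{1..m} - {k}. cmod (lam k - lam t))))"

end

theory Submission
  imports Defs
begin

text \<open>
  Since \<open>P\<close> has \<open>m\<close> distinct eigenvalues, \<open>p\<^sub>i\<^sub>j\<^sup>(\<^sup>n\<^sup>) = \<Sum>\<^sub>k c\<^sub>k \<lambda>\<^sub>k\<^sup>n\<close> with coefficients depending on \<open>i, j\<close>.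
  Applying the polynomial \<open>x \<Prod>\<^sub>t\<^sub>\<noteq>\<^sub>k (x - \<lambda>\<^sub>t)\<close>, whose coefficients are signed elementary symmetric
  polynomials, to this sequence isolates \<open>c\<^sub>k\<close>, so \<open>\<Phi>\<close> is exactly \<open>\<Sum>\<^sub>k\<^sub>\<ge>\<^sub>2 |c\<^sub>k|\<close>. Some power of \<open>P\<close> is entrywise
  positive and contracts the spread of every column, hence \<open>p\<^sub>i\<^sub>j\<^sup>(\<^sup>n\<^sup>)\<close> tends to \<open>\<pi>\<^sub>j\<close>; this forces
  \<open>|\<lambda>\<^sub>k| < 1\<close> for \<open>k \<ge> 2\<close> and \<open>c\<^sub>1 = \<pi>\<^sub>j\<close>.
\<close>

section \<open>Separating exponentials by elementary symmetric polynomials\<close>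

text \<open>Vieta's formula: expand the product over subsets of \<open>T\<close>, then group the
  subsets by cardinality.\<close>

lemma prod_diff_elem_sym:
  fixes x :: "'a::comm_ring_1"
  assumes "finite T"
  shows "(\<Prod>t\<in>T. x - y t) = (\<Sum>l\<le>card T. (-1) ^ (card T - l) * elem_sym (card T - l) T y * x ^ l)"
proof -
  have "(\<Prod>t\<in>T. x - y t) = (\<Sum>S\<in>Pow T. (-1) ^ card S * (\<Prod>t\<in>S. y t) * x ^ (card T - card S))"
    unfolding prod_diff_conv_sum[OF assms]
  proof (intro sum.cong refl)
    fix S assume "S \<in> Pow T"
    then show "(-1) ^ card S * prod y S * (\<Prod>t\<in>T - S. x) = (-1) ^ card S * prod y S * x ^ (card T - card S)"
      using assms by (simp add: card_Diff_subset finite_subset)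
  qed
  also have "\<dots> = (\<Sum>j\<le>card T. \<Sum>S\<in>{S \<in> Pow T. card S = j}. (-1) ^ card S * (\<Prod>t\<in>S. y t) * x ^ (card T - card S))"
    by (rule sum.group[symmetric]) (use assms in \<open>auto intro: card_mono\<close>)
  also have "\<dots> = (\<Sum>j\<le>card T. (-1) ^ j * elem_sym j T y * x ^ (card T - j))"
    by (intro sum.cong refl) (simp add: elem_sym_def sum_distrib_left sum_distrib_right)
  also have "\<dots> = (\<Sum>l\<le>card T. (-1) ^ (card T - l) * elem_sym (card T - l) T y * x ^ l)"
    by (rule sum.reindex_bij_witness[of _ "\<lambda>l. card T - l" "\<lambda>l. card T - l"]) auto
  finally show ?thesis .
qed

text \<open>The weights are the coefficients of the polynomial x times the product of all (x -
  \<open>y t\<close>) with \<open>t\<close> different from \<open>k\<close>. Summed against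
  \<open>a\<close>, they evaluate this polynomial at each \<open>y s\<close>, where it vanishes
  unless \<open>s = k\<close>. The extra factor x is there because \<open>a\<close> is known as an
  exponential sum only from exponent 1 on.\<close>

lemma elem_sym_extract:
  fixes c y :: "nat \<Rightarrow> 'a::comm_ring_1"
  assumes k: "k \<in> {1..m}"
    and a: "\<And>l. 1 \<le> l \<Longrightarrow> a l = (\<Sum>s=1..m. c s * y s ^ l)"
  shows "(\<Sum>l=1..m. (-1) ^ (m - l) * elem_sym (m - l) ({1..m} - {k}) y * a l)
    = c k * y k * (\<Prod>t\<in>{1..m} - {k}. y k - y t)"
proof -
  let ?T = "{1..m} - {k}"
  let ?e = "\<lambda>l. (-1) ^ (m - l) * elem_sym (m - l) ?T y"
  have cT: "card ?T = m - 1" using k by simp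
  have e: "(\<Sum>l=1..m. ?e l * x ^ l) = x * (\<Prod>t\<in>?T. x - y t)" for x
  proof -
    \<comment> \<open>Pulling out one factor x lowers the exponent by one, and
      \<open>m - Suc l = (m - 1) - l\<close> matches the coefficients of the product over the
      \<open>m - 1\<close> elements of \<open>?T\<close>.\<close>
    have "(\<Sum>l=1..m. ?e l * x ^ l) = (\<Sum>l\<le>m - 1. ?e (Suc l) * x ^ Suc l)"
      by (rule sum.reindex_bij_witness[of _ Suc "\<lambda>l. l - 1"]) (use k in auto)
    also have "\<dots> = x * (\<Prod>t\<in>?T. x - y t)"
      unfolding prod_diff_elem_sym[OF finite_Diff[OF finite_atLeastAtMost]] cT sum_distrib_left
      by (intro sum.cong) (simp_all add: mult_ac)
    finally show ?thesis .
  qed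
  have "(\<Sum>l=1..m. ?e l * a l) = (\<Sum>l=1..m. \<Sum>s=1..m. c s * (?e l * y s ^ l))"
    by (intro sum.cong refl) (simp add: a sum_distrib_left mult_ac)
  also have "\<dots> = (\<Sum>s=1..m. c s * (\<Sum>l=1..m. ?e l * y s ^ l))"
    by (subst sum.swap) (simp only: sum_distrib_left)
  also have "\<dots> = (\<Sum>s=1..m. c s * (y s * (\<Prod>t\<in>?T. y s - y t)))"
    by (simp only: e)
  also have "\<dots> = (\<Sum>s\<in>{k}. c s * (y s * (\<Prod>t\<in>?T. y s - y t)))"
  proof (rule sum.mono_neutral_right)
    show "\<forall>s\<in>{1..m} - {k}. c s * (y s * (\<Prod>t\<in>?T. y s - y t)) = 0"
    proof
      fix s assume "s \<in> {1..m} - {k}"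
      then have "(\<Prod>t\<in>?T. y s - y t) = 0" by (intro prod_zero) auto
      then show "c s * (y s * (\<Prod>t\<in>?T. y s - y t)) = 0" by simp
    qed
  qed (use k in auto)
  finally show ?thesis by (simp add: mult_ac)
qed

text \<open>Extraction applied to the zero sequence leaves \<open>c k\<close> times factors that are
  all non-zero. This replaces a Vandermonde determinant.\<close>

lemma distinct_exponentials_independent:
  fixes c y :: "nat \<Rightarrow> 'a::idom"
  assumes inj: "inj_on y {1..m}" and nz: "\<forall>k\<in>{1..m}. y k \<noteq> 0"
    and 0: "\<And>l. 1 \<le> l \<Longrightarrow> (\<Sum>s=1..m. c s * y s ^ l) = 0"
    and k: "k \<in> {1..m}"
  shows "c k = 0"
proof -
  have "c k * y k * (\<Prod>t\<in>{1..m} - {k}. y k - y t) = 0"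
    using elem_sym_extract[OF k, of "\<lambda>_. 0" c y] 0 by simp
  moreover have "y k \<noteq> y t" if "t \<in> {1..m} - {k}" for t
    using inj_onD[OF inj _ k, of t] that by auto
  then have "(\<Prod>t\<in>{1..m} - {k}. y k - y t) \<noteq> 0" by simp
  ultimately show ?thesis using nz k by simp
qed

section \<open>Spectral decomposition of matrix powers\<close>

text \<open>The matrix \<open>U\<close> of eigenvectors diagonalises \<open>A\<close>, so each entry
  of a power is a combination of the powers of the eigenvalues.\<close>

lemma pow_mat_index_expansion:
  fixes A :: "'a::field mat"
  assumes A: "A \<in> carrier_mat m m"
    and bij: "bij_betw lam {1..m} {x. eigenvalue A x}"
    and nz: "\<forall>k\<in>{1..m}. lam k \<noteq> 0"
    and ij: "i < m" "j < m"
  shows "\<exists>c. \<forall>n. (A ^\<^sub>m n) $$ (i, j) = (\<Sum>k=1..m. c k * lam k ^ n)"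
proof -
  have "\<forall>k\<in>{1..m}. \<exists>v. eigenvector A v (lam k)"
    using bij unfolding bij_betw_def eigenvalue_def by blast
  then obtain u where u: "\<forall>k\<in>{1..m}. eigenvector A (u k) (lam k)" by metis
  \<comment> \<open>Columns are numbered from 0 and eigenvalues from 1, hence \<open>Suc s\<close>;
    \<open>shift\<close> below translates between the two ranges.\<close>
  define U where "U = mat m m (\<lambda>(r, s). u (Suc s) $ r)"
  have U: "U \<in> carrier_mat m m" by (simp add: U_def)
  have uc: "u k \<in> carrier_vec m" and unz: "u k \<noteq> 0\<^sub>v m" if "k \<in> {1..m}" for k
    using u that A by (auto simp: eigenvector_def)
  have An: "A ^\<^sub>m n \<in> carrier_mat m m" for n using A by simp
  have AU: "(\<Sum>t<m. (A ^\<^sub>m n) $$ (r, t) * U $$ (t, s)) = lam (Suc s) ^ n * U $$ (r, s)"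
    if "r < m" "s < m" for n r s
  proof -
    have "(\<Sum>t<m. (A ^\<^sub>m n) $$ (r, t) * U $$ (t, s)) = ((A ^\<^sub>m n) *\<^sub>v u (Suc s)) $ r"
      using that An[of n] uc[of "Suc s"] A
      by (auto simp: U_def scalar_prod_def atLeast0LessThan)
    also have "\<dots> = (lam (Suc s) ^ n \<cdot>\<^sub>v u (Suc s)) $ r"
      using eigenvector_pow[OF A, of "u (Suc s)" "lam (Suc s)"] u that by simp
    finally show ?thesis using that uc[of "Suc s"] by (simp add: U_def)
  qed
  have shift: "(\<Sum>s<m. f (Suc s)) = (\<Sum>k=1..m. f k)" for f :: "nat \<Rightarrow> 'a"
    by (rule sum.reindex_bij_witness[of _ "\<lambda>l. l - 1" Suc]) auto
  have "det U \<noteq> 0"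
  proof
    assume "det U = 0"
    then obtain w where w: "w \<in> carrier_vec m" "w \<noteq> 0\<^sub>v m" "U *\<^sub>v w = 0\<^sub>v m"
      using det_0_iff_vec_prod_zero_field[OF U] by blast
    have Uw: "(\<Sum>s<m. U $$ (r, s) * w $ s) = 0" if "r < m" for r
      using arg_cong[OF w(3), of "\<lambda>v. v $ r"] that U w(1)
      by (simp add: scalar_prod_def atLeast0LessThan)
    \<comment> \<open>Applying every power of \<open>A\<close> to \<open>U *\<^sub>v w = 0\<close>
      yields, in each coordinate \<open>r\<close>, a vanishing exponential sum. Independence kills
      its coefficients, although \<open>w\<close> and each \<open>u k\<close> have non-zero
      entries.\<close>
    have wu: "w $ (k - 1) * u k $ r = 0" if k: "k \<in> {1..m}" and r: "r < m" for k r
    proof (rule distinct_exponentials_independent[OF _ nz _ k])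
      show "inj_on lam {1..m}" using bij by (simp add: bij_betw_def)
      fix l :: nat
      have "(\<Sum>k=1..m. w $ (k - 1) * u k $ r * lam k ^ l) = (\<Sum>s<m. lam (Suc s) ^ l * U $$ (r, s) * w $ s)"
        unfolding shift[symmetric] using r by (intro sum.cong) (auto simp: U_def)
      also have "\<dots> = (\<Sum>s<m. (\<Sum>t<m. (A ^\<^sub>m l) $$ (r, t) * U $$ (t, s)) * w $ s)"
        using AU r by simp
      also have "\<dots> = (\<Sum>t<m. (A ^\<^sub>m l) $$ (r, t) * (\<Sum>s<m. U $$ (t, s) * w $ s))"
        unfolding sum_distrib_left sum_distrib_right
        by (subst sum.swap) (simp add: mult_ac)
      also have "\<dots> = 0" using Uw by simp
      finally show "(\<Sum>k=1..m. w $ (k - 1) * u k $ r * lam k ^ l) = 0" .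
    qed
    from w(1,2) obtain s where s: "s < m" "w $ s \<noteq> 0"
      by (auto simp: vec_eq_iff)
    from unz[of "Suc s"] uc[of "Suc s"] s obtain r where "r < m" "u (Suc s) $ r \<noteq> 0"
      by (auto simp: vec_eq_iff)
    with wu[of "Suc s" r] s show False by simp
  qed
  then obtain V where V: "V \<in> carrier_mat m m" and UV: "U * V = 1\<^sub>m m"
    using det_non_zero_imp_unit[OF U, of "()"] by (auto simp: Units_def ring_mat_def)
  have "(A ^\<^sub>m n) $$ (i, j) = (\<Sum>k=1..m. (U $$ (i, k - 1) * V $$ (k - 1, j)) * lam k ^ n)" for n
  proof -
    have "A ^\<^sub>m n = A ^\<^sub>m n * (U * V)" by (simp only: UV right_mult_one_mat[OF An])
    also have "\<dots> = (A ^\<^sub>m n * U) * V" by (rule assoc_mult_mat[OF An U V, symmetric])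
    finally have "(A ^\<^sub>m n) $$ (i, j) = (A ^\<^sub>m n * U * V) $$ (i, j)" by (rule arg_cong)
    also have "\<dots> = (\<Sum>s<m. (A ^\<^sub>m n * U) $$ (i, s) * V $$ (s, j))"
      using ij An[of n] U V A by (simp add: scalar_prod_def atLeast0LessThan)
    also have "\<dots> = (\<Sum>s<m. (\<Sum>t<m. (A ^\<^sub>m n) $$ (i, t) * U $$ (t, s)) * V $$ (s, j))"
      using ij An[of n] U A by (simp add: scalar_prod_def atLeast0LessThan)
    also have "\<dots> = (\<Sum>s<m. (U $$ (i, s) * V $$ (s, j)) * lam (Suc s) ^ n)"
      using AU ij by (simp add: mult_ac)
    also have "\<dots> = (\<Sum>k=1..m. (U $$ (i, k - 1) * V $$ (k - 1, j)) * lam k ^ n)"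
      unfolding shift[symmetric] by simp
    finally show ?thesis .
  qed
  then show ?thesis
    by (intro exI[of _ "\<lambda>k. U $$ (i, k - 1) * V $$ (k - 1, j)"] allI)
qed

section \<open>Convergence to the stationary distribution\<close>

text \<open>The least positive difference between two members of the semigroup divides every member,
  so it is 1. Two consecutive members then generate all large numbers.\<close>

lemma add_closed_Gcd_1_eventually:
  fixes S :: "nat set"
  assumes add: "\<And>a b. a \<in> S \<Longrightarrow> b \<in> S \<Longrightarrow> a + b \<in> S" and gcd: "Gcd S = 1"
  shows "eventually (\<lambda>n. n \<in> S) sequentially"
proof -
  let ?S = "insert 0 S"
  have addS: "a + b \<in> ?S" if "a \<in> ?S" "b \<in> ?S" for a b using that add by auto
  have mult: "q * a \<in> ?S" if "a \<in> ?S" for q a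
    by (induction q) (use that addS in auto)
  define D where "D d \<longleftrightarrow> d > 0 \<and> (\<exists>b\<in>?S. b + d \<in> ?S)" for d
  have "\<exists>d. D d"
  proof -
    have "\<not> S \<subseteq> {0}" using gcd Gcd_0_iff[of S] by auto
    then obtain s where "s \<in> S" "s > 0" by auto
    then show ?thesis unfolding D_def by (intro exI[of _ s]) auto
  qed
  define g where "g = (LEAST d. D d)"
  have "D g" unfolding g_def using \<open>\<exists>d. D d\<close> by (rule LeastI_ex)
  then obtain b where g: "g > 0" and b: "b \<in> ?S" "b + g \<in> ?S"
    unfolding D_def by blast
  \<comment> \<open>Otherwise \<open>?q * (b + g)\<close> and \<open>?q * b + s\<close> are members
    whose difference \<open>s mod g\<close> is positive and smaller than \<open>g\<close>.\<close>
  have "g dvd s" if s: "s \<in> S" for s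
  proof (rule ccontr)
    assume "\<not> g dvd s"
    then have r: "s mod g > 0" by (simp add: dvd_eq_mod_eq_0)
    let ?q = "s div g"
    have "?q * (b + g) + s mod g = ?q * b + s"
      by (simp add: algebra_simps)
    moreover have "?q * b + s \<in> ?S" using addS[OF mult[OF b(1)], of s ?q] s by blast
    ultimately have "?q * (b + g) + s mod g \<in> ?S" by (simp only:)
    then have "D (s mod g)"
      unfolding D_def using r mult[OF b(2), of ?q] by (intro conjI bexI[of _ "?q * (b + g)"])
    then have "g \<le> s mod g" unfolding g_def by (rule Least_le)
    then show False using g by (simp add: not_less[symmetric])
  qed
  then have "g dvd Gcd S" by (rule Gcd_greatest)
  with gcd have "g = 1" by simp
  with b have b1: "b + 1 \<in> ?S" by simp
  \<comment> \<open>From \<open>b * b\<close> on, the quotient by \<open>b\<close> is at least the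
    remainder, so \<open>n\<close> is a sum of copies of \<open>b + 1\<close> and \<open>b\<close>.
    The additional 1 excludes \<open>n = 0\<close>, the element adjoined in
    \<open>?S\<close>.\<close>
  have "n \<in> S" if n: "n \<ge> b * b + 1" for n
  proof -
    have "n \<in> ?S"
    proof (cases "b = 0")
      case True
      then show ?thesis using mult[OF b1, of n] by simp
    next
      case False
      let ?q = "n div b" and ?r = "n mod b"
      have "b \<le> ?q" using n False by (simp add: less_eq_div_iff_mult_less_eq)
      moreover have "?r < b" using False by simp
      ultimately have qr: "?r \<le> ?q" by simp
      have "?r * (b + 1) + (?q - ?r) * b = (?r + (?q - ?r)) * b + ?r"
        by (simp only: distrib_left distrib_right ac_simps mult_1_right)
      also have "\<dots> = n" using qr by simp
      finally show ?thesis using addS[OF mult[OF b1] mult[OF b(1)], of ?r "?q - ?r"] by simp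
    qed
    then show ?thesis using n by auto
  qed
  then show ?thesis unfolding eventually_sequentially by blast
qed

section \<open>Stochastic powers and their eventual positivity\<close>

lemma transition_prob_add:
  assumes P: "P \<in> carrier_mat m m" and ij: "i < m" "j < m"
  shows "transition_prob P (a + b) i j = (\<Sum>k<m. transition_prob P a i k * transition_prob P b k j)"
proof -
  have Pn: "P ^\<^sub>m n \<in> carrier_mat m m" for n using P by simp
  have "P ^\<^sub>m (a + b) = P ^\<^sub>m a * P ^\<^sub>m b"
  proof (induction b)
    case 0
    show ?case using Pn[of a] P by simp
  next
    case (Suc b)
    then show ?case using assoc_mult_mat[OF Pn Pn P] by simp
  qed
  then show ?thesis using Pn[of a] Pn[of b] P ij
    by (simp add: transition_prob_def scalar_prod_def atLeast0LessThan)
qed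

lemma transition_prob_0:
  "P \<in> carrier_mat m m \<Longrightarrow> i < m \<Longrightarrow> j < m \<Longrightarrow> transition_prob P 0 i j = (if i = j then 1 else 0)"
  by (auto simp: transition_prob_def)

lemma transition_prob_1:
  "P \<in> carrier_mat m m \<Longrightarrow> transition_prob P 1 i j = P $$ (i, j)"
  by (simp add: transition_prob_def)

lemma transition_prob_stochastic:
  assumes P: "transition_matrix m P"
  shows "\<forall>i<m. (\<forall>j<m. transition_prob P n i j \<ge> 0) \<and> (\<Sum>j<m. transition_prob P n i j) = 1"
proof -
  have C: "P \<in> carrier_mat m m" using P by (simp add: transition_matrix_def)
  show ?thesis
  proof (induction n)
    case 0
    have "(\<Sum>j<m. transition_prob P 0 i j) = (\<Sum>j<m. if i = j then 1 else 0)" if "i < m" for i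
      using that by (intro sum.cong) (auto simp: transition_prob_0[OF C])
    then show ?case by (simp add: transition_prob_0[OF C])
  next
    case (Suc n)
    have S: "transition_prob P (Suc n) i j = (\<Sum>k<m. transition_prob P n i k * P $$ (k, j))"
      if "i < m" "j < m" for i j
      using transition_prob_add[OF C that, of n 1] by (simp add: transition_prob_1[OF C, simplified])
    show ?case
    proof (intro allI impI conjI)
      fix i j assume "i < m" "j < m"
      then show "transition_prob P (Suc n) i j \<ge> 0"
        using Suc P by (auto simp: S transition_matrix_def intro!: sum_nonneg)
    next
      fix i assume i: "i < m"
      have "(\<Sum>j<m. transition_prob P (Suc n) i j) = (\<Sum>k<m. transition_prob P n i k * (\<Sum>j<m. P $$ (k, j)))"
        using i unfolding sum_distrib_left by (subst sum.swap) (simp add: S)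
      also have "\<dots> = 1" using Suc P i by (simp add: transition_matrix_def)
      finally show "(\<Sum>j<m. transition_prob P (Suc n) i j) = 1" .
    qed
  qed
qed

text \<open>The return times to \<open>i\<close> are closed under addition and have gcd 1, so all
  large times occur. Appending one fixed path from \<open>i\<close> to \<open>j\<close> gives
  positivity for each pair, and there are only finitely many pairs.\<close>

lemma transition_prob_eventually_positive:
  assumes P: "transition_matrix m P" and irr: "irreducible_chain m P" and ap: "aperiodic_chain m P"
  shows "eventually (\<lambda>n. \<forall>i<m. \<forall>j<m. transition_prob P n i j > 0) sequentially"
proof -
  have C: "P \<in> carrier_mat m m" using P by (simp add: transition_matrix_def)
  have path: "transition_prob P (a + b) i j > 0"
    if "i < m" "k < m" "j < m" "transition_prob P a i k > 0" "transition_prob P b k j > 0" for a b i j k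
  proof -
    have "0 < transition_prob P a i k * transition_prob P b k j" using that by simp
    also have "\<dots> \<le> (\<Sum>k<m. transition_prob P a i k * transition_prob P b k j)"
      by (rule member_le_sum) (use that transition_prob_stochastic[OF P] in auto)
    finally show ?thesis using that transition_prob_add[OF C] by simp
  qed
  have "eventually (\<lambda>n. transition_prob P n i j > 0) sequentially" if ij: "i < m" "j < m" for i j
  proof -
    from irr ij obtain b where b: "transition_prob P b i j > 0" by (auto simp: irreducible_chain_def)
    have "eventually (\<lambda>n. n \<in> {n. n \<ge> 1 \<and> transition_prob P n i i > 0}) sequentially"
    proof (rule add_closed_Gcd_1_eventually)
      show "Gcd {n. n \<ge> 1 \<and> transition_prob P n i i > 0} = 1"
        using ap ij by (simp add: aperiodic_chain_def period_def)
    qed (use path ij in auto)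
    then have "eventually (\<lambda>n. transition_prob P (n + b) i j > 0) sequentially"
      by (rule eventually_mono) (use path b ij in auto)
    then show ?thesis
      using eventually_sequentially_seg[of "\<lambda>n. transition_prob P n i j > 0" b] by blast
  qed
  then have "eventually (\<lambda>n. \<forall>i\<in>{..<m}. \<forall>j\<in>{..<m}. transition_prob P n i j > 0) sequentially"
    by (intro eventually_ball_finite ballI) auto
  then show ?thesis by (rule eventually_mono) auto
qed

section \<open>Contraction of column spreads and the limit\<close>

text \<open>
  Subtracting \<open>\<delta>\<close> from every weight leaves non-negative weights of total mass \<open>1 - m \<delta>\<close>, while the
  subtracted part contributes the same amount \<open>\<delta> \<Sum> v\<close> to every average. With \<open>\<delta> = 0\<close> this is the
  monotonicity of the spread.
\<close>

lemma weighted_average_bounds: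
  fixes q v :: "nat \<Rightarrow> real"
  assumes q: "\<forall>k<m. q k \<ge> \<delta>" "(\<Sum>k<m. q k) = 1"
    and v: "\<forall>k<m. lo \<le> v k \<and> v k \<le> lo + d"
  defines "lo' \<equiv> (1 - m * \<delta>) * lo + \<delta> * (\<Sum>k<m. v k)"
  shows "lo' \<le> (\<Sum>k<m. q k * v k) \<and> (\<Sum>k<m. q k * v k) \<le> lo' + (1 - m * \<delta>) * d"
proof -
  have split: "(\<Sum>k<m. q k * v k) = (\<Sum>k<m. (q k - \<delta>) * v k) + \<delta> * (\<Sum>k<m. v k)"
    by (simp add: sum_distrib_left left_diff_distrib sum_subtractf)
  have mass: "(\<Sum>k<m. (q k - \<delta>) * c) = (1 - m * \<delta>) * c" for c
    using q(2) by (simp add: sum_distrib_right[symmetric] sum_subtractf)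
  have "(\<Sum>k<m. (q k - \<delta>) * lo) \<le> (\<Sum>k<m. (q k - \<delta>) * v k)"
    by (intro sum_mono mult_left_mono) (use q v in auto)
  moreover have "(\<Sum>k<m. (q k - \<delta>) * v k) \<le> (\<Sum>k<m. (q k - \<delta>) * (lo + d))"
    by (intro sum_mono mult_left_mono) (use q v in auto)
  ultimately show ?thesis unfolding split mass lo'_def by (simp add: algebra_simps)
qed

lemma stationary_distribution_transition_prob:
  assumes P: "transition_matrix m P" and st: "stationary_distribution m P \<pi>" and j: "j < m"
  shows "(\<Sum>i<m. \<pi> $ i * transition_prob P n i j) = \<pi> $ j"
  using j
proof (induction n arbitrary: j)
  case 0
  have C: "P \<in> carrier_mat m m" using P by (simp add: transition_matrix_def)
  have "(\<Sum>i<m. \<pi> $ i * transition_prob P 0 i j) = (\<Sum>i<m. if i = j then \<pi> $ i else 0)"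
    using 0 by (intro sum.cong) (auto simp: transition_prob_0[OF C])
  then show ?case using 0 by simp
next
  case (Suc n)
  have C: "P \<in> carrier_mat m m" using P by (simp add: transition_matrix_def)
  have "(\<Sum>i<m. \<pi> $ i * transition_prob P (Suc n) i j)
      = (\<Sum>i<m. \<Sum>k<m. \<pi> $ i * transition_prob P n i k * P $$ (k, j))"
    using transition_prob_add[OF C _ Suc.prems, of _ n 1]
    by (simp add: transition_prob_1[OF C, simplified] sum_distrib_left mult_ac)
  also have "\<dots> = (\<Sum>k<m. (\<Sum>i<m. \<pi> $ i * transition_prob P n i k) * P $$ (k, j))"
    unfolding sum_distrib_right by (rule sum.swap)
  also have "\<dots> = \<pi> $ j" using Suc st by (simp add: stationary_distribution_def)
  finally show ?case .
qed

text \<open>By stationarity \<open>\<pi> $ j\<close> is an average of column \<open>j\<close> of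
  every power, so it lies in the same interval as the entries of that column. The length of this
  interval shrinks to 0.\<close>

lemma transition_prob_tendsto:
  assumes P: "transition_matrix m P" and irr: "irreducible_chain m P" and ap: "aperiodic_chain m P"
    and st: "stationary_distribution m P \<pi>" and ij: "i < m" "j < m"
  shows "(\<lambda>n. transition_prob P n i j) \<longlonglongrightarrow> \<pi> $ j"
proof -
  let ?p = "transition_prob P"
  have C: "P \<in> carrier_mat m m" using P by (simp add: transition_matrix_def)
  note sto = transition_prob_stochastic[OF P]
  obtain N where N: "\<forall>i<m. \<forall>j<m. ?p N i j > 0"
    using transition_prob_eventually_positive[OF P irr ap] by (auto simp: eventually_sequentially)
  define \<delta> where "\<delta> = Min ((\<lambda>(i, j). ?p N i j) ` ({..<m} \<times> {..<m}))"
  have "\<delta> \<in> (\<lambda>(i, j). ?p N i j) ` ({..<m} \<times> {..<m})"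
    unfolding \<delta>_def by (rule Min_in) (use ij in auto)
  then have \<delta>0: "\<delta> > 0" using N by auto
  have \<delta>: "?p N i j \<ge> \<delta>" if "i < m" "j < m" for i j
    unfolding \<delta>_def using that by (intro Min_le) auto
  \<comment> \<open>The contraction factor over \<open>N\<close> steps. It is non-negative because a
    row of \<open>m\<close> entries, each at least \<delta>, sums to 1.\<close>
  define c where "c = 1 - m * \<delta>"
  have "(\<Sum>k<m. \<delta>) \<le> (\<Sum>k<m. ?p N i k)" by (intro sum_mono) (use \<delta> ij in auto)
  then have c0: "0 \<le> c" using sto ij by (simp add: c_def)
  have c1: "c < 1" using \<delta>0 ij by (simp add: c_def)
  define spread where "spread n d \<longleftrightarrow> (\<exists>lo. \<forall>i<m. lo \<le> ?p n i j \<and> ?p n i j \<le> lo + d)" for n d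
  \<comment> \<open>Each entry in column \<open>j\<close> at time \<open>a + n\<close> averages that
    column at time \<open>n\<close>, with a row of the \<open>a\<close>-step matrix as
    weights.\<close>
  have step: "spread (a + n) ((1 - m * \<epsilon>) * d)"
    if "spread n d" and \<epsilon>: "\<forall>i<m. \<forall>k<m. ?p a i k \<ge> \<epsilon>" for a n d and \<epsilon> :: real
  proof -
    from \<open>spread n d\<close> obtain lo where lo: "\<forall>k<m. lo \<le> ?p n k j \<and> ?p n k j \<le> lo + d"
      by (auto simp: spread_def)
    show ?thesis unfolding spread_def
    proof (intro exI allI impI)
      fix r assume r: "r < m"
      show "(1 - m * \<epsilon>) * lo + \<epsilon> * (\<Sum>k<m. ?p n k j) \<le> ?p (a + n) r j \<and>
        ?p (a + n) r j \<le> (1 - m * \<epsilon>) * lo + \<epsilon> * (\<Sum>k<m. ?p n k j) + (1 - m * \<epsilon>) * d"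
        unfolding transition_prob_add[OF C r ij(2)]
        by (rule weighted_average_bounds) (use \<epsilon> r sto lo in auto)
    qed
  qed
  have spread_mult: "spread (k * N) (c ^ k)" for k
  proof (induction k)
    case 0
    show ?case unfolding spread_def
      by (rule exI[of _ 0]) (use ij in \<open>auto simp: transition_prob_0[OF C]\<close>)
  next
    case (Suc k)
    then show ?case using step[OF Suc, of \<delta> N] \<delta> by (simp add: c_def)
  qed
  \<comment> \<open>Taking 0 for \<epsilon> carries the spread from \<open>k * N\<close> to any
    later \<open>n\<close>. The averaging lemma with weights \<pi> then places
    \<open>\<pi> $ j\<close> in the same interval.\<close>
  have bound: "\<bar>?p n i j - \<pi> $ j\<bar> \<le> c ^ k" if n: "n \<ge> k * N" for n k
  proof -
    have "spread ((n - k * N) + k * N) ((1 - real m * 0) * c ^ k)"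
      by (rule step[OF spread_mult]) (use sto in auto)
    then obtain lo where lo: "\<forall>i<m. lo \<le> ?p n i j \<and> ?p n i j \<le> lo + c ^ k"
      using n by (auto simp: spread_def)
    have "(1 - real m * 0) * lo + 0 * (\<Sum>i<m. ?p n i j) \<le> (\<Sum>i<m. \<pi> $ i * ?p n i j) \<and>
      (\<Sum>i<m. \<pi> $ i * ?p n i j) \<le> (1 - real m * 0) * lo + 0 * (\<Sum>i<m. ?p n i j) + (1 - real m * 0) * c ^ k"
      by (rule weighted_average_bounds) (use st lo in \<open>auto simp: stationary_distribution_def\<close>)
    then have "lo \<le> \<pi> $ j" "\<pi> $ j \<le> lo + c ^ k"
      using stationary_distribution_transition_prob[OF P st ij(2), of n] by auto
    then show ?thesis using lo ij by (auto simp: abs_le_iff algebra_simps)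
  qed
  show ?thesis
  proof (rule LIMSEQ_I)
    fix e :: real assume "e > 0"
    then obtain k where "c ^ k < e" using real_arch_pow_inv c1 by blast
    then show "\<exists>no. \<forall>n\<ge>no. norm (?p n i j - \<pi> $ j) < e"
      using bound by (intro exI[of _ "k * N"]) (auto intro: le_less_trans)
  qed
qed

section \<open>Moduli of the eigenvalues and the final estimate\<close>

lemma map_mat_of_real_pow_index:
  assumes "P \<in> carrier_mat m m" "i < m" "j < m"
  shows "(map_mat complex_of_real P ^\<^sub>m n) $$ (i, j) = complex_of_real (transition_prob P n i j)"
proof -
  have "P ^\<^sub>m n \<in> carrier_mat m m" using assms by simp
  then show ?thesis using assms
    by (simp add: transition_prob_def of_real_hom.mat_hom_pow[OF assms(1), symmetric])
qed

text \<open>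
  Along an eigenvector with non-zero coordinate \<open>v\<^sub>i\<close>, the sequence \<open>x\<^sup>n v\<^sub>i = (P\<^sup>n v)\<^sub>i\<close> converges;
  for \<open>x \<noteq> 1\<close> powers can only converge to 0.
\<close>

lemma cmod_eigenvalue_less_1:
  assumes P: "transition_matrix m P" and irr: "irreducible_chain m P" and ap: "aperiodic_chain m P"
    and st: "stationary_distribution m P \<pi>"
    and ev: "eigenvalue (map_mat complex_of_real P) x" and x: "x \<noteq> 1"
  shows "cmod x < 1"
proof -
  let ?A = "map_mat complex_of_real P"
  have C: "P \<in> carrier_mat m m" using P by (simp add: transition_matrix_def)
  then have A: "?A \<in> carrier_mat m m" by simp
  from ev obtain v where v: "eigenvector ?A v x" by (auto simp: eigenvalue_def)
  then have vc: "v \<in> carrier_vec m" and "v \<noteq> 0\<^sub>v m" using A by (auto simp: eigenvector_def)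
  then obtain i where i: "i < m" "v $ i \<noteq> 0" by (auto simp: vec_eq_iff)
  have An: "?A ^\<^sub>m n \<in> carrier_mat m m" for n using A by simp
  have "x ^ n = (\<Sum>k<m. complex_of_real (transition_prob P n i k) * v $ k) / v $ i" for n
  proof -
    have "x ^ n * v $ i = (?A ^\<^sub>m n *\<^sub>v v) $ i"
      using eigenvector_pow[OF A v, of n] vc i by simp
    also have "\<dots> = (\<Sum>k<m. (?A ^\<^sub>m n) $$ (i, k) * v $ k)"
      using An[of n] vc i C by (simp add: scalar_prod_def atLeast0LessThan)
    also have "\<dots> = (\<Sum>k<m. complex_of_real (transition_prob P n i k) * v $ k)"
      using map_mat_of_real_pow_index[OF C] i by simp
    finally show ?thesis using i by (simp add: field_simps)
  qed
  then obtain L where L: "(\<lambda>n. x ^ n) \<longlonglongrightarrow> L"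
  proof -
    assume eq: "\<And>n. x ^ n = (\<Sum>k<m. complex_of_real (transition_prob P n i k) * v $ k) / v $ i"
      and thesis: "\<And>L. (\<lambda>n. x ^ n) \<longlonglongrightarrow> L \<Longrightarrow> thesis"
    have "(\<lambda>n. (\<Sum>k<m. complex_of_real (transition_prob P n i k) * v $ k) / v $ i)
        \<longlonglongrightarrow> (\<Sum>k<m. complex_of_real (\<pi> $ k) * v $ k) / v $ i"
      by (intro tendsto_intros transition_prob_tendsto[OF P irr ap st]) (use i in auto)
    then show thesis using thesis by (simp only: eq[symmetric])
  qed
  \<comment> \<open>Shifting the index preserves the limit, so \<open>x * L = L\<close>, which
    leaves only \<open>L = 0\<close>. Some power then has modulus below 1, and hence so does
    \<open>x\<close>.\<close>
  have "(\<lambda>n. x * x ^ n) \<longlonglongrightarrow> x * L" by (intro tendsto_intros L)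
  moreover have "(\<lambda>n. x * x ^ n) \<longlonglongrightarrow> L" using LIMSEQ_Suc[OF L] by simp
  ultimately have "x * L = L" by (rule LIMSEQ_unique)
  with x have "L = 0" by simp
  with L have "(\<lambda>n. norm (x ^ n)) \<longlonglongrightarrow> 0" by (simp add: tendsto_norm_zero)
  then have "eventually (\<lambda>n. norm (x ^ n) < 1) sequentially" by (rule order_tendstoD) simp
  then obtain n where "cmod x ^ n < 1" by (auto simp: eventually_sequentially norm_power)
  then show ?thesis using one_le_power[of "cmod x" n] by linarith
qed

theorem theorem8:
  fixes m :: nat and P :: "real mat" and \<pi> :: "real vec" and lam :: "nat \<Rightarrow> complex"
  assumes "m \<ge> 2"
    and "transition_matrix m P"
    and "irreducible_chain m P"
    and "aperiodic_chain m P"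
    and "stationary_distribution m P \<pi>"
    and "bij_betw lam {1..m} {x. eigenvalue (map_mat complex_of_real P) x}"
    and "\<forall>k\<in>{1..m}. simple_eigenvalue (map_mat complex_of_real P) (lam k)"
    and "\<forall>k\<in>{1..m}. lam k \<noteq> 0"
    and "lam 1 = 1"
  shows "\<forall>i<m. \<forall>j<m. \<forall>n\<ge>1.
           \<bar>transition_prob P n i j - \<pi> $ j\<bar> \<le> Phi m P lam i j * rho m lam ^ n"
proof (intro allI impI)
  fix i j n :: nat
  assume ij: "i < m" "j < m"
  let ?A = "map_mat complex_of_real P"
  have C: "P \<in> carrier_mat m m" using assms(2) by (simp add: transition_matrix_def)
  then have A: "?A \<in> carrier_mat m m" by simp
  have inj: "inj_on lam {1..m}" using assms(6) by (simp add: bij_betw_def)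
  obtain c where c: "\<And>n. complex_of_real (transition_prob P n i j) = (\<Sum>k=1..m. c k * lam k ^ n)"
    using pow_mat_index_expansion[OF A assms(6,8) ij] map_mat_of_real_pow_index[OF C ij] by auto
  have split: "{1..m} = insert 1 {2..m}" using assms(1) by auto
  have c': "complex_of_real (transition_prob P n i j) = c 1 + (\<Sum>k=2..m. c k * lam k ^ n)" for n
    unfolding c split using assms(9) by simp
  have lam1: "cmod (lam k) < 1" if k: "k \<in> {2..m}" for k
  proof (rule cmod_eigenvalue_less_1[OF assms(2-5)])
    show "eigenvalue ?A (lam k)" using assms(6) k by (auto simp: bij_betw_def)
    show "lam k \<noteq> 1" using inj_onD[OF inj, of k 1] assms(1,9) k by auto
  qed
  \<comment> \<open>All terms with \<open>k\<close> from 2 on decay, so the coefficient of the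
    eigenvalue 1 is the limit of the transition probabilities.\<close>
  have c1: "c 1 = complex_of_real (\<pi> $ j)"
  proof (rule LIMSEQ_unique)
    have "(\<lambda>n. c 1 + (\<Sum>k=2..m. c k * lam k ^ n)) \<longlonglongrightarrow> c 1 + (\<Sum>k=2..m. c k * 0)"
      by (intro tendsto_intros LIMSEQ_power_zero) (use lam1 in auto)
    then show "(\<lambda>n. complex_of_real (transition_prob P n i j)) \<longlonglongrightarrow> c 1" by (simp add: c')
    show "(\<lambda>n. complex_of_real (transition_prob P n i j)) \<longlonglongrightarrow> complex_of_real (\<pi> $ j)"
      by (intro tendsto_intros transition_prob_tendsto[OF assms(2-5) ij])
  qed
  \<comment> \<open>The strict bound on the modulus ensures that no \<open>k\<close> from 2 on is
    filtered out of the set whose maximum is \<open>rho\<close>.\<close>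
  have rho: "cmod (lam k) \<le> rho m lam" if k: "k \<in> {2..m}" for k
    unfolding rho_def
  proof (rule Max_ge)
    have "complex_of_real (cmod (lam k)) \<noteq> lam 1"
      using lam1[OF k] assms(9) by simp
    then show "cmod (lam k) \<in> {cmod (lam k) |k. k \<in> {1..m} \<and> complex_of_real (cmod (lam k)) \<noteq> lam 1}"
      using k by auto
  qed auto
  let ?R = "\<lambda>k. cmod (lam k) * (\<Prod>t\<in>{1..m} - {k}. cmod (lam k - lam t))"
  let ?N = "\<lambda>k. cmod (\<Sum>l=1..m. (-1) ^ (m - l) * elem_sym (m - l) ({1..m} - {k}) lam
    * complex_of_real (transition_prob P l i j))"
  \<comment> \<open>Extraction turns the numerator in \<open>Phi\<close> into \<open>c k\<close>
    times the quantity whose modulus is the denominator; this is non-zero because the eigenvalues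
    are distinct and non-zero.\<close>
  have ck: "cmod (c k) = ?N k / ?R k" if k: "k \<in> {2..m}" for k
  proof -
    have k1: "k \<in> {1..m}" using k by simp
    have "?N k = cmod (c k) * ?R k"
      by (subst elem_sym_extract[OF k1 c]) (simp add: norm_mult prod_norm[symmetric] mult_ac)
    moreover have "lam k \<noteq> lam t" if "t \<in> {1..m} - {k}" for t
      using inj_onD[OF inj _ k1, of t] that by auto
    then have "?R k \<noteq> 0"
      using assms(8) k1 by simp
    ultimately show ?thesis by simp
  qed
  have "\<bar>transition_prob P n i j - \<pi> $ j\<bar> = cmod (complex_of_real (transition_prob P n i j) - complex_of_real (\<pi> $ j))"
    by (simp flip: of_real_diff)
  also have "\<dots> = cmod (\<Sum>k=2..m. c k * lam k ^ n)" unfolding c' c1 by simp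
  also have "\<dots> \<le> (\<Sum>k=2..m. cmod (c k) * cmod (lam k) ^ n)"
    by (rule order_trans[OF norm_sum]) (simp add: norm_mult norm_power)
  also have "\<dots> \<le> (\<Sum>k=2..m. cmod (c k) * rho m lam ^ n)"
    by (intro sum_mono mult_left_mono power_mono rho) auto
  also have "\<dots> = Phi m P lam i j * rho m lam ^ n"
    by (simp add: Phi_def ck sum_distrib_right)
  finally show "\<bar>transition_prob P n i j - \<pi> $ j\<bar> \<le> Phi m P lam i j * rho m lam ^ n" .
qed

end
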